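(* Let $D$ be a connected local tournament of order $n$. Then $\gamma^{LD}(D) \leq \lceil \frac{n}{2} \rceil$.
   Context: All digraphs are finite and loopless. A digraph is simple if there is at most one arc between any two vertices. A digraph is connected if its underlying undirected graph is connected. For a vertex $v$, $N^-(v)$ and $N^+(v)$ denote the sets of in-neighbours and out-neighbours of $v$. A tournament is a digraph with exactly one arc between every pair of distinct vertices. A local tournament is a simple digraph in which, for every vertex $v$, both $N^-(v)$ and $N^+(v)$ induce tournaments. A set $S$ of vertices is dominating if every vertex not in $S$ has an in-neighbour in $S$; it is locating if for every two distinct vertices $x,y\notin S$ there is $s\in S$ that is an in-neighbour of exactly one of $x,y$. $\gamma^{LD}(D)$ is the minimum size of a set that is both locating and dominating. *)

theory Defs
  imports Complex_Main "Graph_Theory.Graph_Theory"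
begin

definition in_neighbours :: "('a, 'b) pre_digraph \<Rightarrow> 'a \<Rightarrow> 'a set" where
  "in_neighbours D v = {u \<in> verts D. u \<rightarrow>\<^bsub>D\<^esub> v}"

definition out_neighbours :: "('a, 'b) pre_digraph \<Rightarrow> 'a \<Rightarrow> 'a set" where
  "out_neighbours D v = {u \<in> verts D. v \<rightarrow>\<^bsub>D\<^esub> u}"

text \<open>Arcs joining two vertices are counted irrespective of their direction. The locale
  \<^locale>\<open>digraph\<close> excludes loops and parallel arcs but allows a pair of opposite arcs;
  simple digraphs exclude the latter as well.\<close>

definition arcs_between :: "('a, 'b) pre_digraph \<Rightarrow> 'a \<Rightarrow> 'a \<Rightarrow> 'b set" where
  "arcs_between D u v = {e \<in> arcs D. {tail D e, head D e} = {u, v}}"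

definition simple_digraph :: "('a, 'b) pre_digraph \<Rightarrow> bool" where
  "simple_digraph D \<longleftrightarrow>
     digraph D \<and> (\<forall>u\<in>verts D. \<forall>v\<in>verts D. card (arcs_between D u v) \<le> 1)"

text \<open>The null digraph counts as a tournament, so that an empty neighbourhood imposes no
  restriction in a local tournament.\<close>

definition tournament :: "('a, 'b) pre_digraph \<Rightarrow> bool" where
  "tournament D \<longleftrightarrow>
     digraph D \<and> (\<forall>u\<in>verts D. \<forall>v\<in>verts D. u \<noteq> v \<longrightarrow> card (arcs_between D u v) = 1)"

definition local_tournament :: "('a, 'b) pre_digraph \<Rightarrow> bool" where
  "local_tournament D \<longleftrightarrow>
     simple_digraph D \<and>
     (\<forall>v\<in>verts D. tournament (D \<restriction> in_neighbours D v) \<and> tournament (D \<restriction> out_neighbours D v))"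

definition dominating :: "('a, 'b) pre_digraph \<Rightarrow> 'a set \<Rightarrow> bool" where
  "dominating D S \<longleftrightarrow>
     S \<subseteq> verts D \<and> (\<forall>v\<in>verts D - S. \<exists>s\<in>S. s \<in> in_neighbours D v)"

definition locating :: "('a, 'b) pre_digraph \<Rightarrow> 'a set \<Rightarrow> bool" where
  "locating D S \<longleftrightarrow>
     S \<subseteq> verts D \<and>
     (\<forall>x\<in>verts D - S. \<forall>y\<in>verts D - S. x \<noteq> y \<longrightarrow>
        (\<exists>s\<in>S. (s \<in> in_neighbours D x) \<noteq> (s \<in> in_neighbours D y)))"

definition gamma_LD :: "('a, 'b) pre_digraph \<Rightarrow> nat" where
  "gamma_LD D = (LEAST k. \<exists>S. locating D S \<and> dominating D S \<and> card S = k)"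

text \<open>The minimum is always attained, since the whole vertex set is locating and dominating.\<close>

lemma gamma_LD_attained:
  "\<exists>S. locating D S \<and> dominating D S \<and> card S = gamma_LD D"
proof -
  have "\<exists>S. locating D S \<and> dominating D S \<and> card S = card (verts D)"
    by (intro exI[of _ "verts D"]) (auto simp: locating_def dominating_def)
  then show ?thesis
    unfolding gamma_LD_def by (rule LeastI)
qed

lemma gamma_LD_le:
  "locating D S \<Longrightarrow> dominating D S \<Longrightarrow> gamma_LD D \<le> card S"
  unfolding gamma_LD_def by (rule Least_le) blast

end

theory Submission
  imports Defs "HOL-Library.Z2"
begin

text \<open>Induction on the order. Put a vertex \<open>x\<close> into the set. Its out-neighbourhood is then separated
  from the rest and dominated, so there it suffices to locate, and a tournament of odd order \<open>m\<close> has a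
  locating set of size \<open>(m - 1) div 2\<close>: each odd out-neighbourhood pays for its vertex. If \<open>x\<close> lies in
  the terminal part of the digraph, what remains is again connected. The same works for an arc
  \<open>x \<rightarrow> y\<close> of the terminal part with an odd number of common out-neighbours. If neither parity
  condition can be met, all out-neighbourhoods in the terminal part \<open>U\<close> have even size and even
  pairwise intersections (two nonadjacent vertices have no common out-neighbour). Over the
  two-element field the corresponding rows of the adjacency matrix span a self-orthogonal space,
  whose dimension is at most \<open>card U / 2\<close>. The vertices of a row basis locate and dominate \<open>U\<close>, since
  the columns are nonzero and distinct, and the induction continues on \<open>V - U\<close>.\<close>

subsection \<open>Self-orthogonal families over the two-element field\<close>

text \<open>The functionals of a minimal determining subfamily \<open>S\<close> admit dual vectors; together with \<open>S\<close>
  itself they are independent, because their Gram matrix has the block form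
  \<open>(0, I; I, *)\<close>. Hence \<open>4 ^ card S \<le> 2 ^ card U\<close>.\<close>

lemma sum_mult_add_swap:
  fixes h :: "'a \<Rightarrow> 'c :: comm_semiring_0"
  shows "(\<Sum>u\<in>U. h u * ((\<Sum>t\<in>T. f t u) + (\<Sum>t\<in>T'. z t u))) =
    (\<Sum>t\<in>T. \<Sum>u\<in>U. h u * f t u) + (\<Sum>t\<in>T'. \<Sum>u\<in>U. h u * z t u)"
  by (simp add: distrib_left sum.distrib sum_distrib_left sum.swap[of _ U])

lemma self_orthogonal_determining_subfamily:
  fixes f :: "'b \<Rightarrow> 'a \<Rightarrow> bit"
  assumes finU: "finite U" and finB: "finite B"
    and orth: "\<And>b c. b \<in> B \<Longrightarrow> c \<in> B \<Longrightarrow> (\<Sum>u\<in>U. f b u * f c u) = 0"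
  shows "\<exists>S\<subseteq>B. 2 * card S \<le> card U \<and> (\<forall>g.
    (\<forall>s\<in>S. (\<Sum>u\<in>U. f s u * g u) = 0) \<longrightarrow> (\<forall>b\<in>B. (\<Sum>u\<in>U. f b u * g u) = 0))"
proof -
  define P where "P S \<longleftrightarrow> S \<subseteq> B \<and> (\<forall>g. (\<forall>s\<in>S. (\<Sum>u\<in>U. f s u * g u) = 0) \<longrightarrow>
    (\<forall>b\<in>B. (\<Sum>u\<in>U. f b u * g u) = 0))" for S
  have "P B" by (simp add: P_def)
  then obtain S where S: "P S" and minS: "\<And>S'. P S' \<Longrightarrow> card S \<le> card S'"
    using ex_has_least_nat[of P B card] by blast
  have SB: "S \<subseteq> B" using S by (simp add: P_def)
  have finS: "finite S" using SB finB finite_subset by blast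
  \<comment> \<open>By minimality \<open>S - {s}\<close> no longer determines \<open>B\<close>, so
    some \<open>g\<close> orthogonal to it is not orthogonal to all of \<open>B\<close>. As
    \<open>S\<close> does determine \<open>B\<close>, this \<open>g\<close> cannot be orthogonal to
    \<open>f s\<close>.\<close>
  have "\<exists>g. (\<forall>t\<in>S - {s}. (\<Sum>u\<in>U. f t u * g u) = 0) \<and> (\<Sum>u\<in>U. f s u * g u) = 1"
    if s: "s \<in> S" for s
  proof -
    have "\<not> P (S - {s})"
      using minS[of "S - {s}"] card_Diff1_less[OF finS s] by linarith
    then obtain g b where g: "\<forall>t\<in>S - {s}. (\<Sum>u\<in>U. f t u * g u) = 0"
      and b: "b \<in> B" "(\<Sum>u\<in>U. f b u * g u) \<noteq> 0"
      using SB unfolding P_def by blast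
    have "(\<Sum>u\<in>U. f s u * g u) \<noteq> 0"
      using S b g unfolding P_def by (metis Diff_iff singletonD)
    then show ?thesis using g by auto
  qed
  then obtain z where z: "\<And>s t. s \<in> S \<Longrightarrow> t \<in> S \<Longrightarrow>
      (\<Sum>u\<in>U. f t u * z s u) = (if t = s then 1 else 0)"
    by (metis Diff_iff singletonD)
  \<comment> \<open>Support of a sum of chosen \<open>f t\<close> and \<open>z t\<close>.
    Injectivity of \<open>F\<close> says that these \<open>2 * card S\<close> vectors are
    independent over the two-element field.\<close>
  define F where "F = (\<lambda>(T, T'). {u \<in> U. (\<Sum>t\<in>T. f t u) + (\<Sum>t\<in>T'. z t u) = (1 :: bit)})"
  have "inj_on F (Pow S \<times> Pow S)"
  proof (rule inj_onI)
    fix p q assume p: "p \<in> Pow S \<times> Pow S" and q: "q \<in> Pow S \<times> Pow S" and Fpq: "F p = F q"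
    obtain T T' where pT: "p = (T, T')" and T: "T \<subseteq> S" "T' \<subseteq> S" using p by auto
    obtain X X' where qX: "q = (X, X')" and X: "X \<subseteq> S" "X' \<subseteq> S" using q by auto
    have eq: "(\<Sum>t\<in>T. f t u) + (\<Sum>t\<in>T'. z t u) = (\<Sum>t\<in>X. f t u) + (\<Sum>t\<in>X'. z t u)"
      if "u \<in> U" for u
    proof -
      have "u \<in> F (T, T') \<longleftrightarrow> u \<in> F (X, X')" using Fpq pT qX by simp
      then have "(\<Sum>t\<in>T. f t u) + (\<Sum>t\<in>T'. z t u) = 1 \<longleftrightarrow>
          (\<Sum>t\<in>X. f t u) + (\<Sum>t\<in>X'. z t u) = 1"
        using that unfolding F_def by blast
      then show ?thesis by (metis (full_types) bit_not_one_iff)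
    qed
    have fin: "finite T" "finite T'" "finite X" "finite X'"
      using T X finS finite_subset by blast+
    have eqh: "(\<Sum>t\<in>T. \<Sum>u\<in>U. h u * f t u) + (\<Sum>t\<in>T'. \<Sum>u\<in>U. h u * z t u) =
        (\<Sum>t\<in>X. \<Sum>u\<in>U. h u * f t u) + (\<Sum>t\<in>X'. \<Sum>u\<in>U. h u * z t u)" for h
      unfolding sum_mult_add_swap[symmetric] using eq by (intro sum.cong) simp_all
    have orthS: "(\<Sum>t\<in>Y. \<Sum>u\<in>U. f s u * f t u) = 0" if "s \<in> S" "Y \<subseteq> S" for s Y
      using that SB by (intro sum.neutral ballI orth) auto
    have dual: "(\<Sum>t\<in>Y. \<Sum>u\<in>U. f s u * z t u) = (if s \<in> Y then 1 else 0)"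
      if "s \<in> S" "Y \<subseteq> S" "finite Y" for s Y
    proof -
      have "(\<Sum>t\<in>Y. \<Sum>u\<in>U. f s u * z t u) = (\<Sum>t\<in>Y. if s = t then 1 else 0)"
        using that by (intro sum.cong refl z) auto
      also have "\<dots> = (if s \<in> Y then 1 else 0)"
        using that(3) by (rule sum.delta')
      finally show ?thesis .
    qed
    have dual': "(\<Sum>t\<in>Y. \<Sum>u\<in>U. z s u * f t u) = (if s \<in> Y then 1 else 0)"
      if "s \<in> S" "Y \<subseteq> S" "finite Y" for s Y
    proof -
      have "(\<Sum>t\<in>Y. \<Sum>u\<in>U. z s u * f t u) = (\<Sum>t\<in>Y. if t = s then 1 else 0)"
        unfolding mult.commute[of "z s _"] using that by (intro sum.cong refl z) auto
      also have "\<dots> = (if s \<in> Y then 1 else 0)"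
        using that(3) by (rule sum.delta)
      finally show ?thesis .
    qed
    \<comment> \<open>Pairing with \<open>f s\<close> annihilates the \<open>f\<close> part and
      detects membership in the second component.\<close>
    have "s \<in> T' \<longleftrightarrow> s \<in> X'" if "s \<in> S" for s
      using eqh[of "f s"] unfolding orthS[OF that T(1)] orthS[OF that X(1)]
        add_0 dual[OF that T(2) fin(2)] dual[OF that X(2) fin(4)]
      by (simp only: split: if_splits) simp_all
    then have T': "T' = X'" using T X by blast
    \<comment> \<open>With \<open>T' = X'\<close>, the unknown products among dual vectors cancel,
      so pairing with \<open>z s\<close> detects the first component.\<close>
    have "s \<in> T \<longleftrightarrow> s \<in> X" if "s \<in> S" for s
      using eqh[of "z s"] unfolding T' dual'[OF that T(1) fin(1)] dual'[OF that X(1) fin(3)]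
      by (simp only: add_right_cancel split: if_splits) simp_all
    then show "p = q" using T X T' pT qX by blast
  qed
  moreover have "F ` (Pow S \<times> Pow S) \<subseteq> Pow U" by (auto simp: F_def)
  ultimately have "card (Pow S \<times> Pow S) \<le> card (Pow U)"
    using finU by (intro card_inj_on_le[of F]) auto
  then have "(2 :: nat) ^ (2 * card S) \<le> 2 ^ card U"
    using finU finS by (simp add: card_cartesian_product card_Pow mult_2 power_add)
  then have "2 * card S \<le> card U" by (simp add: power_increasing_iff)
  with S show ?thesis unfolding P_def by blast
qed

subsection \<open>Local tournaments as relations\<close>

text \<open>The vertex set is a parameter of every notion below rather than of the locale, so the
  induction passes to induced subdigraphs while \<open>R\<close> stays fixed.\<close>

locale local_tournament_rel =
  fixes R :: "'a \<Rightarrow> 'a \<Rightarrow> bool"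
  assumes asym: "R u v \<Longrightarrow> \<not> R v u"
    and out_tour: "R u v \<Longrightarrow> R u w \<Longrightarrow> v \<noteq> w \<Longrightarrow> R v w \<or> R w v"
    and in_tour: "R v u \<Longrightarrow> R w u \<Longrightarrow> v \<noteq> w \<Longrightarrow> R v w \<or> R w v"
begin

definition total :: "'a set \<Rightarrow> bool" where
  "total V \<longleftrightarrow> (\<forall>u\<in>V. \<forall>v\<in>V. u \<noteq> v \<longrightarrow> R u v \<or> R v u)"

text \<open>Connectedness in cut form: the proofs below refute a set \<open>K\<close> with no arc
  across its boundary. The empty set counts as connected, so nothing special happens when a deletion
  leaves no vertex.\<close>

definition conn :: "'a set \<Rightarrow> bool" where
  "conn V \<longleftrightarrow> (\<forall>K\<subseteq>V. K \<noteq> {} \<longrightarrow> K \<noteq> V \<longrightarrow> (\<exists>u\<in>K. \<exists>v\<in>V - K. R u v \<or> R v u))"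

definition out :: "'a set \<Rightarrow> 'a \<Rightarrow> 'a set" where
  "out V x = {y \<in> V. R x y}"

definition step :: "'a set \<Rightarrow> 'a \<Rightarrow> 'a \<Rightarrow> bool" where
  "step V u v \<longleftrightarrow> u \<in> V \<and> v \<in> V \<and> R u v"

definition loc :: "'a set \<Rightarrow> 'a set \<Rightarrow> bool" where
  "loc V S \<longleftrightarrow> (\<forall>u\<in>V - S. \<forall>v\<in>V - S. u \<noteq> v \<longrightarrow> (\<exists>s\<in>S. R s u \<noteq> R s v))"

definition dom :: "'a set \<Rightarrow> 'a set \<Rightarrow> bool" where
  "dom V S \<longleftrightarrow> (\<forall>u\<in>V - S. \<exists>s\<in>S. R s u)"

text \<open>For \<open>e = 1\<close> this is the bound of the theorem. The case \<open>e = 0\<close> drops domination and is the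
  sharper bound needed inside an out-neighbourhood, which is dominated already.\<close>

definition good :: "'a set \<Rightarrow> nat \<Rightarrow> bool" where
  "good V e \<longleftrightarrow> (\<exists>S\<subseteq>V. 2 * card S \<le> card V + e \<and> loc V S \<and> (e = 0 \<or> dom V S))"

text \<open>One predicate for both bounds makes them a single induction: the step for
  \<open>e = 1\<close> uses \<open>e = 0\<close> inside out-neighbourhoods.\<close>

definition admissible :: "'a set \<Rightarrow> nat \<Rightarrow> bool" where
  "admissible V e \<longleftrightarrow> finite V \<and> conn V \<and> e \<le> 1 \<and> (e = 0 \<longrightarrow> total V)"

lemma irrefl: "\<not> R u u"
  using asym by blast

lemma total_subset: "total V \<Longrightarrow> W \<subseteq> V \<Longrightarrow> total W"
  unfolding total_def by blast

lemma total_out: "total (out V x)"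
  unfolding total_def out_def using out_tour by blast

lemma total_imp_conn: "total V \<Longrightarrow> conn V"
  unfolding total_def conn_def by (metis Diff_iff equals0I subset_iff subset_antisym)

lemma admissible_subset_out:
  assumes "finite V" "A \<subseteq> out V x"
  shows "admissible A 0"
proof -
  have "total A" using total_subset[OF total_out assms(2)] .
  moreover have "finite A" using assms by (auto simp: out_def intro: finite_subset)
  ultimately show ?thesis by (simp add: admissible_def total_imp_conn)
qed

text \<open>Having an out-neighbour in \<open>K\<close> propagates along the path from
  \<open>y\<close> to \<open>x\<close>: if \<open>p\<close> has out-neighbours \<open>k\<close> in
  \<open>K\<close> and \<open>q\<close> outside, then \<open>k\<close> and \<open>q\<close> are
  adjacent, and closedness of \<open>K\<close> forces the arc from \<open>q\<close> to
  \<open>k\<close>.\<close>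

lemma step_to_closed:
  assumes "(step V)\<^sup>*\<^sup>* y x" "x \<notin> K" "z \<in> K" "step V y z"
    and closed: "\<And>k w. k \<in> K \<Longrightarrow> step V k w \<Longrightarrow> w \<in> K"
  shows "\<exists>k\<in>K. step V x k"
  using assms(1,2)
proof (induction rule: rtranclp_induct)
  case base
  then show ?case using assms by blast
next
  case (step p q)
  then have "p \<notin> K" using closed by blast
  then obtain k where k: "k \<in> K" "step V p k" using step by blast
  then have "k \<noteq> q" using step by blast
  then have "R k q \<or> R q k" using out_tour[of p k q] k step by (simp add: step_def)
  moreover have "\<not> step V k q" using closed k step by blast
  ultimately show ?case using k step by (auto simp: step_def)
qed

end

text \<open>\<open>U\<close> is the set reached from a vertex of positive out-degree whose reach is minimal, and \<open>B\<close>
  consists of the vertices of \<open>U\<close> that are not sinks.\<close>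

locale terminal_part = local_tournament_rel +
  fixes V U B :: "'a set"
  assumes finV: "finite V" and connV: "conn V" and UV: "U \<subseteq> V"
    and closedU: "u \<in> U \<Longrightarrow> v \<in> V \<Longrightarrow> R u v \<Longrightarrow> v \<in> U"
    and B_def: "B = {u \<in> U. out V u \<noteq> {}}"
    and B_ne: "B \<noteq> {}"
    and reach: "b \<in> B \<Longrightarrow> u \<in> U \<Longrightarrow> (step V)\<^sup>*\<^sup>* b u"
begin

lemma BU: "B \<subseteq> U"
  by (auto simp: B_def)

lemma in_B: "u \<in> U \<Longrightarrow> v \<in> V \<Longrightarrow> R u v \<Longrightarrow> u \<in> B"
  by (auto simp: B_def out_def)

lemma out_subset_U: "b \<in> U \<Longrightarrow> out V b \<subseteq> U"
  using closedU by (auto simp: out_def)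

section \<open>Connectedness after deletions in the terminal part\<close>

text \<open>Domination by \<open>k\<close> travels backwards along a path from \<open>b\<close> to
  \<open>u\<close>: two in-neighbours of the same vertex are adjacent, and an arc towards
  \<open>k\<close> would leave \<open>U\<close>.\<close>

lemma outside_dominates_B:
  assumes "k \<in> V - U" "R k u" "u \<in> U" "b \<in> B"
  shows "R k b"
proof -
  have "(step V)\<^sup>*\<^sup>* b u" using reach assms by blast
  moreover have "b \<in> U" using assms BU by blast
  ultimately show ?thesis using assms(2)
  proof (induction rule: converse_rtranclp_induct)
    case base
    then show ?case by simp
  next
    case (step b c)
    then have "c \<in> U" using closedU by (auto simp: step_def)
    then have "R k c" using step by blast
    moreover have "b \<noteq> k" using step assms by blast
    ultimately have "R b k \<or> R k b" using in_tour[of b c k] step by (simp add: step_def)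
    then show ?case using closedU step assms by blast
  qed
qed

text \<open>A part of \<open>V - U\<close> without arcs to the rest of \<open>V - U\<close> must
  send an arc into \<open>U\<close>, hence dominates any fixed \<open>b\<close> in \<open>B\<close>.
  In-neighbours of \<open>b\<close> are pairwise adjacent, so there cannot be two such
  parts.\<close>

lemma conn_minus_U: "conn (V - U)"
  unfolding conn_def
proof (intro allI impI, rule ccontr)
  fix K assume K: "K \<subseteq> V - U" "K \<noteq> {}" "K \<noteq> V - U"
    and no: "\<not> (\<exists>u\<in>K. \<exists>v\<in>V - U - K. R u v \<or> R v u)"
  obtain b where b: "b \<in> B" using B_ne by blast
  have dom_b: "\<exists>k\<in>L. R k b" if L: "L \<subseteq> V - U" "L \<noteq> {}"
    "\<not> (\<exists>u\<in>L. \<exists>v\<in>V - U - L. R u v \<or> R v u)" for L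
  proof -
    have "L \<noteq> V" using L b BU UV by blast
    then obtain u v where uv: "u \<in> L" "v \<in> V - L" "R u v \<or> R v u"
      using connV L unfolding conn_def by (metis Diff_subset subset_trans)
    then have v: "v \<in> U" using L by blast
    then have "R u v" using uv closedU[of v u] L by blast
    then show ?thesis using outside_dominates_B[of u v b] uv v b L by blast
  qed
  obtain k where k: "k \<in> K" "R k b" using dom_b[OF K(1,2) no] by blast
  have "\<exists>k\<in>V - U - K. R k b" using K no by (intro dom_b) auto
  then obtain l where l: "l \<in> V - U - K" "R l b" by blast
  then have "R k l \<or> R l k" using k in_tour by blast
  then show False using no k l by blast
qed

text \<open>Every part of \<open>W\<close> without arcs to the rest of \<open>W\<close> contains an
  in-neighbour of \<open>x\<close>, and these are pairwise adjacent. The choice \<open>y = x\<close>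
  covers the deletion of a single closed out-neighbourhood.\<close>

lemma conn_minus_closed_outs:
  assumes x: "x \<in> B" and y: "y \<in> U" "y = x \<or> R x y"
  defines "W \<equiv> V - ({x, y} \<union> out V x \<union> out V y)"
  shows "conn W"
  unfolding conn_def
proof (intro allI impI, rule ccontr)
  fix K assume K: "K \<subseteq> W" "K \<noteq> {}" "K \<noteq> W"
    and no: "\<not> (\<exists>u\<in>K. \<exists>v\<in>W - K. R u v \<or> R v u)"
  have xV: "x \<in> V" "x \<in> U" "y \<in> V" using x y BU UV by auto
  have meets: "\<exists>k\<in>L. R k x" if L: "L \<subseteq> W" "L \<noteq> {}" "\<not> (\<exists>u\<in>L. \<exists>v\<in>W - L. R u v \<or> R v u)" for L
  proof (rule ccontr)
    assume nox: "\<not> (\<exists>k\<in>L. R k x)"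
    have LV: "L \<subseteq> V" and notin: "\<And>l. l \<in> L \<Longrightarrow> \<not> R x l \<and> \<not> R y l \<and> l \<noteq> x \<and> l \<noteq> y"
      using L by (auto simp: W_def out_def)
    have noy: "\<not> R l y" if "l \<in> L" for l
      using in_tour[of l y x] y nox notin that by blast
    \<comment> \<open>A step leaving \<open>L\<close> would end in an out-neighbour of
      \<open>x\<close> or \<open>y\<close>, making its start adjacent to \<open>x\<close> or
      \<open>y\<close>.\<close>
    have closed: "w \<in> L" if l: "l \<in> L" and st: "step V l w" for l w
    proof (rule ccontr)
      assume "w \<notin> L"
      then have "w \<notin> W" using L l st by (auto simp: step_def)
      then have "R x w \<or> R y w"
        using st nox noy l by (auto simp: W_def step_def out_def)
      then show False using in_tour[of x w l] in_tour[of y w l] st notin nox noy l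
        by (auto simp: step_def)
    qed
    have "L \<noteq> V" using xV notin by blast
    then obtain u v where uv: "u \<in> L" "v \<in> V - L" "R u v \<or> R v u"
      using connV L LV unfolding conn_def by metis
    \<comment> \<open>The arc supplied by connectedness thus enters \<open>L\<close>. Its start lies
      in \<open>U\<close> and so reaches \<open>x\<close>, which then gets an out-neighbour in
      \<open>L\<close>, although \<open>W\<close> contains none.\<close>
    then have vu: "R v u" using closed LV by (auto simp: step_def)
    then have "v \<notin> W" using L uv by blast
    then have "v \<in> U" using uv vu notin xV y out_subset_U by (auto simp: W_def)
    then have "v \<in> B" using in_B vu uv LV by blast
    then have "(step V)\<^sup>*\<^sup>* v x" using reach xV by blast
    moreover have "step V v u" using uv vu LV by (auto simp: step_def)
    ultimately have "\<exists>k\<in>L. step V x k"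
      using step_to_closed[of V v x L u] closed uv notin by blast
    then show False using notin by (auto simp: step_def)
  qed
  obtain k where k: "k \<in> K" "R k x" using meets[OF K(1,2) no] by blast
  have "\<exists>k\<in>W - K. R k x" using K no by (intro meets) auto
  then obtain l where l: "l \<in> W - K" "R l x" by blast
  then have "R k l \<or> R l k" using k in_tour by blast
  then show False using no k l by blast
qed

section \<open>Splitting off out-neighbourhoods\<close>

text \<open>The vertex \<open>x\<close> dominates its out-neighbourhood and separates it from the
  remaining vertices, so sets for the two sides combine.\<close>

lemma good_split_out:
  assumes x: "x \<in> B" and A: "good (out V x) 0" and W: "good (V - ({x} \<union> out V x)) e"
    and odd: "odd (card (out V x)) \<or> even (card V + e)"
  shows "good V e"
proof -
  define W where "W = V - ({x} \<union> out V x)"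
  obtain S where S: "S \<subseteq> out V x" "2 * card S \<le> card (out V x)" "loc (out V x) S"
    using A by (auto simp: good_def)
  obtain T where T: "T \<subseteq> W" "2 * card T \<le> card W + e" "loc W T" "e = 0 \<or> dom W T"
    using W by (auto simp: good_def W_def)
  have xV: "x \<in> V" using x BU UV by blast
  have V: "V = {x} \<union> out V x \<union> W" by (auto simp: W_def out_def xV)
  have fin: "finite (out V x)" "finite W"
    using finV by (auto simp: W_def out_def)
  have "x \<notin> out V x" by (simp add: out_def irrefl)
  then have cV: "card V = 1 + card (out V x) + card W"
    using fin by (subst V, subst card_Un_disjoint) (auto simp: W_def)
  let ?X = "{x} \<union> S \<union> T"
  have cX: "card ?X \<le> 1 + card S + card T"
    using card_Un_le[of "{x} \<union> S" T] card_Un_le[of "{x}" S] by simp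
  \<comment> \<open>Adding the bounds gives \<open>card V + e + 1\<close>, one too many. An odd
    out-neighbourhood saves one, since \<open>2 * card S\<close> is even; if
    \<open>card V + e\<close> is even, the excess is lost by parity.\<close>
  have "2 * card ?X \<le> card V + e"
    using odd
  proof
    assume "odd (card (out V x))"
    then obtain k where "card (out V x) = 2 * k + 1" by (rule oddE)
    moreover from this have "card S \<le> k" using S(2) by linarith
    ultimately show ?thesis using T(2) cV cX by linarith
  next
    assume "even (card V + e)"
    then obtain k where "card V + e = 2 * k" by (rule evenE)
    moreover from this have "card ?X \<le> k" using S(2) T(2) cV cX by linarith
    ultimately show ?thesis by linarith
  qed
  moreover have "loc V ?X"
    unfolding loc_def
  proof (intro ballI impI)
    fix u v assume uv: "u \<in> V - ?X" "v \<in> V - ?X" "u \<noteq> v"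
    show "\<exists>s\<in>?X. R s u \<noteq> R s v"
    proof (cases "R x u = R x v")
      case True
      then have "u \<in> out V x - S \<and> v \<in> out V x - S \<or> u \<in> W - T \<and> v \<in> W - T"
        using uv by (auto simp: W_def out_def)
      then show ?thesis using S(3) T(3) uv(3) unfolding loc_def by blast
    qed auto
  qed
  moreover have "e = 0 \<or> dom V ?X"
  proof -
    have "dom V ?X" if "dom W T"
      using that unfolding dom_def W_def out_def by blast
    then show ?thesis using T by blast
  qed
  moreover have "?X \<subseteq> V" using S T xV by (auto simp: out_def W_def)
  ultimately show ?thesis unfolding good_def by blast
qed

text \<open>Vertices not told apart by \<open>x\<close> and \<open>y\<close> lie in the same one of
  four classes, each of which has its own locating set.\<close>

lemma good_split_two_outs:
  assumes x: "x \<in> B" and y: "y \<in> U" "R x y"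
    and good1: "good (out V x \<inter> out V y) 0" and good2: "good (out V x - ({y} \<union> out V y)) 0"
    and good3: "good (out V y - out V x) 0"
    and good4: "good (V - ({x, y} \<union> out V x \<union> out V y)) e"
    and ev: "even (card (out V x))" "even (card (out V y))"
    and odd: "odd (card (out V x \<inter> out V y))" "odd (card V + e)"
  shows "good V e"
proof -
  define A1 where "A1 = out V x \<inter> out V y"
  define A2 where "A2 = out V x - ({y} \<union> out V y)"
  define A3 where "A3 = out V y - out V x"
  define W where "W = V - ({x, y} \<union> out V x \<union> out V y)"
  obtain S1 where S1: "S1 \<subseteq> A1" "2 * card S1 \<le> card A1" "loc A1 S1"
    using good1 by (auto simp: good_def A1_def)
  obtain S2 where S2: "S2 \<subseteq> A2" "2 * card S2 \<le> card A2" "loc A2 S2"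
    using good2 by (auto simp: good_def A2_def)
  obtain S3 where S3: "S3 \<subseteq> A3" "2 * card S3 \<le> card A3" "loc A3 S3"
    using good3 by (auto simp: good_def A3_def)
  obtain T where T: "T \<subseteq> W" "2 * card T \<le> card W + e" "loc W T" "e = 0 \<or> dom W T"
    using good4 by (auto simp: good_def W_def)
  have xV: "x \<in> V" "y \<in> V" using x y BU UV by auto
  have notin: "x \<notin> out V x" "y \<notin> out V y" "x \<notin> out V y" "y \<in> out V x" "x \<noteq> y"
    using asym y xV by (auto simp: out_def irrefl)
  have fin: "finite (out V x)" "finite (out V y)" "finite W" "finite A1" "finite A2" "finite A3"
    using finV by (auto simp: W_def out_def A1_def A2_def A3_def)
  have cx: "card (out V x) = 1 + card A1 + card A2"
  proof -
    have "out V x = {y} \<union> A1 \<union> A2" using notin by (auto simp: A1_def A2_def)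
    moreover have "card ({y} \<union> A1 \<union> A2) = 1 + card A1 + card A2"
      using fin notin by (subst card_Un_disjoint) (auto simp: A1_def A2_def)
    ultimately show ?thesis by simp
  qed
  have cy: "card (out V y) = card A1 + card A3"
  proof -
    have "out V y = A1 \<union> A3" by (auto simp: A1_def A3_def)
    moreover have "card (A1 \<union> A3) = card A1 + card A3"
      using fin by (subst card_Un_disjoint) (auto simp: A1_def A3_def)
    ultimately show ?thesis by simp
  qed
  have cV: "card V = 1 + card (out V x) + card A3 + card W"
  proof -
    have "V = {x} \<union> out V x \<union> A3 \<union> W" using notin xV by (auto simp: W_def A3_def out_def)
    moreover have "card ({x} \<union> out V x \<union> A3 \<union> W) = card ({x} \<union> out V x \<union> A3) + card W"
      using fin by (intro card_Un_disjoint) (auto simp: A3_def W_def)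
    moreover have "card ({x} \<union> out V x \<union> A3) = card ({x} \<union> out V x) + card A3"
      using fin notin by (intro card_Un_disjoint) (auto simp: A3_def)
    ultimately show ?thesis using fin notin by simp
  qed
  let ?X = "{x, y} \<union> S1 \<union> S2 \<union> S3 \<union> T"
  have "card ?X \<le> 2 + card S1 + card S2 + card S3 + card T"
    using card_Un_le[of "{x, y} \<union> S1 \<union> S2 \<union> S3" T] card_Un_le[of "{x, y} \<union> S1 \<union> S2" S3]
      card_Un_le[of "{x, y} \<union> S1" S2] card_Un_le[of "{x, y}" S1] notin by simp
  moreover have "odd (card A1)" using odd by (simp add: A1_def)
  \<comment> \<open>Adding the bounds overshoots by two. Since \<open>card A1\<close> is odd,
    \<open>card A3\<close> is odd too, and each of these classes saves one.\<close>
  ultimately have "2 * card ?X \<le> card V + e"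
    using S1(2) S2(2) S3(2) T(2) cV cx cy odd(2) ev by presburger
  moreover have "loc V ?X"
    unfolding loc_def
  proof (intro ballI impI)
    fix u v assume uv: "u \<in> V - ?X" "v \<in> V - ?X" "u \<noteq> v"
    show "\<exists>s\<in>?X. R s u \<noteq> R s v"
    proof (cases "R x u = R x v \<and> R y u = R y v")
      case True
      then have "u \<in> A1 - S1 \<and> v \<in> A1 - S1 \<or> u \<in> A2 - S2 \<and> v \<in> A2 - S2
          \<or> u \<in> A3 - S3 \<and> v \<in> A3 - S3 \<or> u \<in> W - T \<and> v \<in> W - T"
        using uv by (auto simp: W_def out_def A1_def A2_def A3_def)
      then show ?thesis using S1(3) S2(3) S3(3) T(3) uv(3) unfolding loc_def by blast
    qed auto
  qed
  moreover have "e = 0 \<or> dom V ?X"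
  proof -
    have "dom V ?X" if "dom W T"
      using that unfolding dom_def W_def out_def by blast
    then show ?thesis using T by blast
  qed
  moreover have "?X \<subseteq> V" using S1(1) S2(1) S3(1) T(1) xV
    by (auto simp: out_def W_def A1_def A2_def A3_def)
  ultimately show ?thesis unfolding good_def by blast
qed

section \<open>The case of even intersections\<close>

text \<open>Makes every column of the adjacency matrix nonzero: a path to \<open>z\<close> from
  another vertex of \<open>B\<close> ends with an arc from \<open>B\<close>.\<close>

lemma B_dominates_U:
  assumes ev: "\<And>b. b \<in> B \<Longrightarrow> even (card (out V b))" and z: "z \<in> U"
  obtains p where "p \<in> B" "R p z"
proof -
  \<comment> \<open>A vertex \<open>z\<close> of \<open>B\<close> has at least two out-neighbours by
    parity; two of them are adjacent, so one is not a sink.\<close>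
  have "\<exists>b\<in>B. b \<noteq> z"
  proof (cases "z \<in> B")
    case True
    have "finite (out V z)" using finV by (simp add: out_def)
    moreover have "out V z \<noteq> {}" using True by (simp add: B_def)
    moreover have "card (out V z) \<noteq> 1" using ev[OF True] by auto
    ultimately obtain p q where pq: "p \<in> out V z" "q \<in> out V z" "p \<noteq> q"
      by (metis card_1_singletonE is_singletonI' is_singleton_altdef)
    then have "R p q \<or> R q p" "p \<in> U" "q \<in> U" "p \<noteq> z" "q \<noteq> z"
      using out_tour[of z p q] z out_subset_U[of z] irrefl by (auto simp: out_def)
    then show ?thesis using in_B UV by blast
  next
    case False
    then show ?thesis using B_ne by (metis ex_in_conv)
  qed
  then obtain b where b: "b \<in> B" "b \<noteq> z" by blast
  then obtain p where p: "(step V)\<^sup>*\<^sup>* b p" "step V p z"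
    using reach[OF b(1) z] by (metis rtranclp.cases)
  have "p \<in> U" using p(1)
  proof (induction rule: rtranclp_induct)
    case base
    then show ?case using b BU by blast
  next
    case (step p q)
    then show ?case using closedU by (simp add: step_def)
  qed
  then show ?thesis using that[of p] in_B p(2) by (auto simp: step_def)
qed

lemma good_if_even_common_outs:
  assumes ev: "\<And>b. b \<in> B \<Longrightarrow> even (card (out V b))"
    and evc: "\<And>b c. b \<in> B \<Longrightarrow> c \<in> B \<Longrightarrow> R b c \<Longrightarrow> even (card (out V b \<inter> out V c))"
    and rest: "good (V - U) e"
  shows "good V e"
proof -
  define f where "f b u = (of_bool (R b u) :: bit)" for b u
  have finU: "finite U" and finB: "finite B"
    using finV UV BU by (meson finite_subset)+
  have evc': "even (card (out V b \<inter> out V c))" if "b \<in> B" "c \<in> B" for b c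
  proof (cases "b = c \<or> R b c \<or> R c b")
    case True
    then show ?thesis using evc[of b c] evc[of c b] ev[of b] that by (auto simp: Int_commute)
  next
    case False
    then have "out V b \<inter> out V c = {}" using in_tour[of b _ c] by (auto simp: out_def)
    then show ?thesis by simp
  qed
  have orth: "(\<Sum>u\<in>U. f b u * f c u) = 0" if "b \<in> B" "c \<in> B" for b c
  proof -
    have "(\<Sum>u\<in>U. f b u * f c u) = (\<Sum>u\<in>U. of_bool (u \<in> out V b \<inter> out V c))"
      using UV by (intro sum.cong) (auto simp: f_def out_def)
    also have "\<dots> = of_nat (card (U \<inter> (out V b \<inter> out V c)))"
      using finU by (simp add: Int_def)
    also have "U \<inter> (out V b \<inter> out V c) = out V b \<inter> out V c"
      using out_subset_U that BU by blast
    finally have sum: "(\<Sum>u\<in>U. f b u * f c u) = of_nat (card (out V b \<inter> out V c))" .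
    have "even (card (out V b \<inter> out V c))" using evc' that by blast
    then obtain k where "card (out V b \<inter> out V c) = 2 * k" by blast
    then show ?thesis unfolding sum by simp
  qed
  from self_orthogonal_determining_subfamily[OF finU finB orth]
  obtain S where det_S: "S \<subseteq> B \<and> 2 * card S \<le> card U \<and> (\<forall>g.
    (\<forall>s\<in>S. (\<Sum>u\<in>U. f s u * g u) = 0) \<longrightarrow> (\<forall>b\<in>B. (\<Sum>u\<in>U. f b u * g u) = 0))" ..
  have S: "S \<subseteq> B" "2 * card S \<le> card U" using det_S by simp_all
  have det: "(\<Sum>u\<in>U. f b u * g u) = 0"
    if "\<And>s. s \<in> S \<Longrightarrow> (\<Sum>u\<in>U. f s u * g u) = 0" "b \<in> B" for g b
    by (rule det_S[THEN conjunct2, THEN conjunct2, rule_format, OF that])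
  obtain T where T: "T \<subseteq> V - U" "2 * card T \<le> card (V - U) + e" "loc (V - U) T"
    "e = 0 \<or> dom (V - U) T"
    using rest by (auto simp: good_def)
  have delta: "(\<Sum>u\<in>U. f b u * of_bool (u = z)) = f b z" if "z \<in> U" for b z
  proof -
    have "(\<Sum>u\<in>U. f b u * of_bool (u = z)) = (\<Sum>u\<in>U. if u = z then f b u else 0)"
      by (intro sum.cong refl) (simp only: of_bool_def mult_1_right mult_zero_right split: if_split, simp)
    also have "\<dots> = (if z \<in> U then f b z else 0)"
      using finU by (rule sum.delta)
    finally show ?thesis using that by (simp only: if_True)
  qed
  \<comment> \<open>If \<open>S\<close> misses \<open>z\<close>, the indicator of \<open>z\<close>
    is orthogonal to the rows of \<open>S\<close>, hence to all rows of \<open>B\<close>, so column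
    \<open>z\<close> would vanish.\<close>
  have domU: "\<exists>s\<in>S. R s z" if z: "z \<in> U" for z
  proof (rule ccontr)
    assume "\<not> (\<exists>s\<in>S. R s z)"
    then have "(\<Sum>u\<in>U. f s u * of_bool (u = z)) = 0" if "s \<in> S" for s
      using that delta[OF z] by (simp add: f_def)
    then have "f b z = 0" if "b \<in> B" for b
      using that delta[OF z] det by metis
    then show False using B_dominates_U[OF ev z] by (metis f_def of_bool_eq(2) one_neq_zero)
  qed
  \<comment> \<open>The same with the sum of two indicators: if \<open>S\<close> does not separate
    \<open>z\<close> and \<open>w\<close>, their columns agree on all of \<open>B\<close>.\<close>
  have locU: "\<exists>s\<in>S. R s z \<noteq> R s w" if zw: "z \<in> U" "w \<in> U" "z \<noteq> w" for z w
  proof (rule ccontr)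
    assume eq: "\<not> (\<exists>s\<in>S. R s z \<noteq> R s w)"
    have delta2: "(\<Sum>u\<in>U. f b u * (of_bool (u = z) + of_bool (u = w))) = f b z + f b w" for b
      unfolding distrib_left sum.distrib by (simp only: delta zw)
    have "(\<Sum>u\<in>U. f s u * (of_bool (u = z) + of_bool (u = w))) = 0" if "s \<in> S" for s
      unfolding delta2 using eq that by (simp add: f_def)
    then have "f b z + f b w = 0" if "b \<in> B" for b
      using det[OF _ that, of "\<lambda>u. of_bool (u = z) + of_bool (u = w)"] unfolding delta2 by blast
    then have same: "R b z \<longleftrightarrow> R b w" if "b \<in> B" for b
      using that unfolding f_def by (metis add_0_left add_0_right of_bool_eq one_neq_zero)
    obtain p where p: "p \<in> B" "R p z" using B_dominates_U[OF ev zw(1)] .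
    \<comment> \<open>A common in-neighbour makes \<open>z\<close> and \<open>w\<close> adjacent.
      The tail of that arc lies in \<open>B\<close>, so equality of the columns would give it a
      loop.\<close>
    then have "R z w \<or> R w z" using same out_tour zw(3) by blast
    then show False using same in_B UV zw irrefl by blast
  qed
  let ?X = "S \<union> T"
  have "card U + card (V - U) = card V"
    using finV UV by (metis card_Diff_subset card_mono finU le_add_diff_inverse)
  then have "2 * card ?X \<le> card V + e"
    using S(2) T(2) card_Un_le[of S T] by linarith
  \<comment> \<open>No arc leaves \<open>U\<close>, so an in-neighbour in \<open>S\<close> also
    separates a vertex of \<open>U\<close> from every vertex outside.\<close>
  moreover have out: "\<not> R s v" if "s \<in> S" "v \<in> V - U" for s v
    using that closedU S BU by blast
  have "loc V ?X"
    unfolding loc_def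
  proof (intro ballI impI)
    fix u v assume uv: "u \<in> V - ?X" "v \<in> V - ?X" "u \<noteq> v"
    consider "u \<in> U" "v \<in> U" | "u \<in> U" "v \<notin> U" | "u \<notin> U" "v \<in> U" | "u \<notin> U" "v \<notin> U" by blast
    then show "\<exists>s\<in>?X. R s u \<noteq> R s v"
    proof cases
      case 1
      then show ?thesis using locU uv by blast
    next
      case 2
      then show ?thesis using domU[of u] out[of _ v] uv by blast
    next
      case 3
      then show ?thesis using domU[of v] out[of _ u] uv by blast
    next
      case 4
      then show ?thesis using T(3) uv unfolding loc_def by blast
    qed
  qed
  moreover have "e = 0 \<or> dom V ?X"
    using T(4) domU unfolding dom_def by blast
  moreover have "?X \<subseteq> V" using S T BU UV by blast
  ultimately show ?thesis unfolding good_def by blast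
qed

end

section \<open>The induction on the order\<close>

context local_tournament_rel
begin

text \<open>A vertex of positive out-degree in a minimal reach \<open>Rch x\<close> reaches a subset
  of \<open>Rch x\<close>, hence by minimality all of it.\<close>

lemma exists_terminal_part:
  assumes "finite V" "conn V" "x0 \<in> V" "out V x0 \<noteq> {}"
  obtains U B where "terminal_part R V U B"
proof -
  define Rch where "Rch x = {u. (step V)\<^sup>*\<^sup>* x u}" for x
  define P where "P x \<longleftrightarrow> x \<in> V \<and> out V x \<noteq> {}" for x
  obtain x where x: "P x" and min: "\<And>y. P y \<Longrightarrow> card (Rch x) \<le> card (Rch y)"
    using ex_has_least_nat[of P x0 "\<lambda>x. card (Rch x)"] assms by (auto simp: P_def)
  have sub: "Rch y \<subseteq> V" if "y \<in> V" for y
  proof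
    fix u assume "u \<in> Rch y"
    then have "(step V)\<^sup>*\<^sup>* y u" by (simp add: Rch_def)
    then show "u \<in> V" using that by (induction) (auto simp: step_def)
  qed
  have fin: "finite (Rch x)"
    using sub[of x] x assms finite_subset by (auto simp: P_def)
  have "terminal_part R V (Rch x) {u \<in> Rch x. out V u \<noteq> {}}"
  proof
    show "finite V" "conn V" by fact+
    show "Rch x \<subseteq> V" using sub x by (auto simp: P_def)
    show "v \<in> Rch x" if "u \<in> Rch x" "v \<in> V" "R u v" for u v
    proof -
      have "step V u v" using that \<open>Rch x \<subseteq> V\<close> by (auto simp: step_def)
      then show ?thesis using that by (auto simp: Rch_def)
    qed
    show "{u \<in> Rch x. out V u \<noteq> {}} \<noteq> {}" using x by (auto simp: Rch_def P_def)
    show "(step V)\<^sup>*\<^sup>* b u" if "b \<in> {u \<in> Rch x. out V u \<noteq> {}}" "u \<in> Rch x" for b u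
    proof -
      have "Rch b \<subseteq> Rch x" using that by (auto simp: Rch_def intro: rtranclp_trans)
      moreover have "card (Rch x) \<le> card (Rch b)"
        using that \<open>Rch x \<subseteq> V\<close> by (intro min) (auto simp: P_def)
      ultimately have "Rch b = Rch x" using fin card_seteq by blast
      then show ?thesis using that by (auto simp: Rch_def)
    qed
  qed simp
  then show ?thesis using that by blast
qed

lemma admissible_imp_good: "admissible V e \<Longrightarrow> good V e"
proof (induction "card V" arbitrary: V e rule: less_induct)
  case less
  then have fin: "finite V" and conn: "conn V" and e: "e \<le> 1" and tot: "e = 0 \<Longrightarrow> total V"
    by (auto simp: admissible_def)
  show ?case
  proof (cases "\<exists>x\<in>V. out V x \<noteq> {}")
    case False
    \<comment> \<open>Without arcs, connectedness leaves at most one vertex: the empty set serves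
      for \<open>e = 0\<close> and \<open>V\<close> itself for \<open>e = 1\<close>.\<close>
    have small: "u = v" if "u \<in> V" "v \<in> V" for u v
    proof (rule ccontr)
      assume "u \<noteq> v"
      then have "\<exists>a\<in>{u}. \<exists>b\<in>V - {u}. R a b \<or> R b a"
        using conn that unfolding conn_def by (metis empty_not_insert empty_subsetI insert_subset singletonD)
      then show False using False that by (auto simp: out_def)
    qed
    then have "card V \<le> 1" using fin by (simp add: card_le_Suc0_iff_eq)
    then have "2 * card (if e = 0 then {} else V) \<le> card V + e" using e by auto
    moreover have "loc V (if e = 0 then {} else V)" using small by (auto simp: loc_def)
    moreover have "e = 0 \<or> dom V (if e = 0 then {} else V)" by (auto simp: dom_def)
    ultimately show ?thesis unfolding good_def by (metis empty_subsetI order_refl)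
  next
    case True
    then obtain U B where "terminal_part R V U B"
      using exists_terminal_part[OF fin conn] by blast
    then interpret terminal_part R V U B .
    \<comment> \<open>Parts of an out-neighbourhood of \<open>x\<close> are total and omit
      \<open>x\<close>, so induction gives the sharper bound.\<close>
    have IHout: "good A 0" if "A \<subseteq> out V x" "x \<in> V" for A x
    proof (rule less.hyps)
      have "A \<subset> V" using that irrefl by (auto simp: out_def)
      then show "card A < card V" using fin psubset_card_mono by blast
      show "admissible A 0" using admissible_subset_out fin that by blast
    qed
    have IH: "good (V - A) e" if "conn (V - A)" "A \<inter> V \<noteq> {}" for A
    proof (rule less.hyps)
      show "card (V - A) < card V" using fin that by (intro psubset_card_mono) auto
      show "admissible (V - A) e"
        using fin that e tot total_subset[of V "V - A"] by (auto simp: admissible_def)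
    qed
    have inV: "x \<in> V" if "x \<in> B" for x using that BU UV by blast
    show ?thesis
    proof (cases "(\<exists>x\<in>B. odd (card (out V x))) \<or> even (card V + e)")
      case True
      then obtain x where x: "x \<in> B" "odd (card (out V x)) \<or> even (card V + e)"
        using B_ne by blast
      have "conn (V - ({x} \<union> out V x))"
        using conn_minus_closed_outs[of x x] x BU by auto
      then have "good (V - ({x} \<union> out V x)) e" using IH inV x by auto
      then show ?thesis using good_split_out x IHout[of "out V x" x] inV by blast
    next
      case ev: False
      show ?thesis
      proof (cases "\<exists>x\<in>B. \<exists>y\<in>B. R x y \<and> odd (card (out V x \<inter> out V y))")
        case True
        then obtain x y where xy: "x \<in> B" "y \<in> B" "R x y" "odd (card (out V x \<inter> out V y))"
          by blast
        have "conn (V - ({x, y} \<union> out V x \<union> out V y))"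
          using conn_minus_closed_outs[of x y] xy BU by blast
        then have "good (V - ({x, y} \<union> out V x \<union> out V y)) e" using IH inV xy by auto
        moreover have "good (out V x \<inter> out V y) 0" "good (out V x - ({y} \<union> out V y)) 0"
          "good (out V y - out V x) 0"
          using IHout inV xy by (meson Diff_subset Int_lower1)+
        ultimately show ?thesis using good_split_two_outs[of x y e] xy BU ev by blast
      next
        case False
        have "good (V - U) e" using IH[OF conn_minus_U] B_ne BU UV by blast
        then show ?thesis using good_if_even_common_outs ev False by blast
      qed
    qed
  qed
qed

end

subsection \<open>Application to digraphs\<close>

text \<open>Opposite arcs are distinct, as there are no loops, yet have the same ends and would both
  be counted by \<open>arcs_between\<close>.\<close>

lemma simple_digraph_asym:
  assumes D: "simple_digraph D" and uv: "u \<rightarrow>\<^bsub>D\<^esub> v"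
  shows "\<not> v \<rightarrow>\<^bsub>D\<^esub> u"
proof
  assume vu: "v \<rightarrow>\<^bsub>D\<^esub> u"
  interpret digraph D using D by (simp add: simple_digraph_def)
  obtain e where e: "e \<in> arcs D" "tail D e = u" "head D e = v"
    using uv by (auto simp: arcs_ends_def arc_to_ends_def)
  obtain e' where e': "e' \<in> arcs D" "tail D e' = v" "head D e' = u"
    using vu by (auto simp: arcs_ends_def arc_to_ends_def)
  have "e \<noteq> e'" using no_loops e e' by metis
  moreover have "{e, e'} \<subseteq> arcs_between D u v"
    using e e' by (auto simp: arcs_between_def)
  moreover have "finite (arcs_between D u v)" by (simp add: arcs_between_def)
  ultimately have "2 \<le> card (arcs_between D u v)" by (metis card_2_iff card_mono)
  moreover have "u \<in> verts D" "v \<in> verts D" using uv adj_in_verts by auto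
  ultimately show False using D by (fastforce simp: simple_digraph_def)
qed

lemma tournament_induced_adjacent:
  assumes "tournament (D \<restriction> A)" "u \<in> A" "v \<in> A" "u \<noteq> v"
  shows "u \<rightarrow>\<^bsub>D\<^esub> v \<or> v \<rightarrow>\<^bsub>D\<^esub> u"
proof -
  have "card (arcs_between (D \<restriction> A) u v) = 1"
    using assms by (simp add: tournament_def)
  then have "arcs_between (D \<restriction> A) u v \<noteq> {}" by fastforce
  then obtain e where "e \<in> arcs D" "{tail D e, head D e} = {u, v}"
    by (auto simp: arcs_between_def)
  then show ?thesis by (auto simp: arcs_ends_def arc_to_ends_def doubleton_eq_iff)
qed

lemma local_tournament_rel_adj:
  assumes D: "local_tournament D"
  shows "local_tournament_rel (\<lambda>u v. u \<rightarrow>\<^bsub>D\<^esub> v)"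
proof
  have sD: "simple_digraph D" using D by (simp add: local_tournament_def)
  interpret digraph D using sD by (simp add: simple_digraph_def)
  show "\<not> v \<rightarrow>\<^bsub>D\<^esub> u" if "u \<rightarrow>\<^bsub>D\<^esub> v" for u v
    using simple_digraph_asym[OF sD that] .
  show "v \<rightarrow>\<^bsub>D\<^esub> w \<or> w \<rightarrow>\<^bsub>D\<^esub> v" if "u \<rightarrow>\<^bsub>D\<^esub> v" "u \<rightarrow>\<^bsub>D\<^esub> w" "v \<noteq> w" for u v w
    using that D adj_in_verts
    by (intro tournament_induced_adjacent[of D "out_neighbours D u"])
      (auto simp: local_tournament_def out_neighbours_def)
  show "v \<rightarrow>\<^bsub>D\<^esub> w \<or> w \<rightarrow>\<^bsub>D\<^esub> v" if "v \<rightarrow>\<^bsub>D\<^esub> u" "w \<rightarrow>\<^bsub>D\<^esub> u" "v \<noteq> w" for u v w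
    using that D adj_in_verts
    by (intro tournament_induced_adjacent[of D "in_neighbours D u"])
      (auto simp: local_tournament_def in_neighbours_def)
qed

text \<open>Without a crossing arc, a path in the symmetric closure that starts in \<open>K\<close>
  never leaves \<open>K\<close>.\<close>

lemma connected_imp_crossing_arc:
  assumes con: "Digraph_Component.connected D" and K: "K \<subseteq> verts D" "K \<noteq> {}" "K \<noteq> verts D"
  shows "\<exists>u\<in>K. \<exists>v\<in>verts D - K. u \<rightarrow>\<^bsub>D\<^esub> v \<or> v \<rightarrow>\<^bsub>D\<^esub> u"
proof (rule ccontr)
  assume no: "\<not> ?thesis"
  obtain u v where uv: "u \<in> K" "v \<in> verts D" "v \<notin> K" using K by blast
  have "u \<rightarrow>\<^sup>*\<^bsub>with_proj (mk_symmetric D)\<^esub> v"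
    using con uv K by (auto simp: Digraph_Component.connected_def strongly_connected_def)
  then have "(u, v) \<in> rtrancl_on (verts D) (parcs (mk_symmetric D))"
    by (simp add: reachable_def)
  then have "v \<in> K"
  proof (induction rule: rtrancl_on_induct)
    case base
    then show ?case using uv by simp
  next
    case (step y z)
    then have "y \<rightarrow>\<^bsub>D\<^esub> z \<or> z \<rightarrow>\<^bsub>D\<^esub> y"
      by (auto simp: parcs_mk_symmetric arcs_ends_def arc_to_ends_def)
    then show ?case using no step by blast
  qed
  then show False using uv by simp
qed

theorem theorem1:
  fixes D :: "('a, 'b) pre_digraph" and n :: nat
  assumes "local_tournament D"
    and "Digraph_Component.connected D"
    and "card (verts D) = n"
  shows "int (gamma_LD D) \<le> \<lceil>real n / 2\<rceil>"
proof -
  interpret digraph D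
    using assms(1) by (simp add: local_tournament_def simple_digraph_def)
  interpret local_tournament_rel "\<lambda>u v. u \<rightarrow>\<^bsub>D\<^esub> v"
    using local_tournament_rel_adj[OF assms(1)] .
  have "conn (verts D)"
    using connected_imp_crossing_arc[OF assms(2)] by (simp add: conn_def)
  then have "good (verts D) 1"
    by (intro admissible_imp_good) (simp add: admissible_def)
  then obtain S where S: "S \<subseteq> verts D" "2 * card S \<le> n + 1" "loc (verts D) S" "dom (verts D) S"
    using assms(3) by (auto simp: good_def)
  have "locating D S"
    unfolding locating_def in_neighbours_def using S(1,3) unfolding loc_def by blast
  moreover have "dominating D S"
    unfolding dominating_def in_neighbours_def using S(1,4) unfolding dom_def by blast
  ultimately have "2 * gamma_LD D \<le> n + 1"
    using gamma_LD_le S(2) by fastforce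
  then show ?thesis by linarith
qed

end
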